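(* Let $T \in \mathcal{T}_{n,\Delta}$ be a tree and let $v_0 \in V(T)$ be a vertex of maximum degree $\Delta$. For any support vertex $v_\ell$ of $T$, different from $v_0$, with $\deg_T(v_\ell) \geq 3$, there exists another tree $T' \in \mathcal{T}_{n,\Delta}$ such that $\operatorname{irr}(T') < \operatorname{irr}(T)$.
   Context: All graphs are finite and simple. $\mathcal{T}_{n,\Delta}$ denotes the class of trees with $n$ vertices and maximum degree $\Delta$. A leaf (pendant vertex) is a vertex of degree $1$; a support vertex is a vertex adjacent to at least one leaf. The Albertson (irregularity) index of a graph $G$ is $\operatorname{irr}(G)=\sum_{uv\in E(G)} |d_G(u)-d_G(v)|$, where $d_G(u)$ (also written $\deg_G(u)$) is the degree of $u$ in $G$. *)

theory Defs
  imports "Graph_Theory.Graph_Theory"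
begin

text \<open>
  Finite simple graphs are the library's \<^locale>\<open>pair_graph\<close>s: finite, loop-free, symmetric
  digraphs whose arcs are pairs of vertices. An undirected edge \<open>uv\<close> is represented by the two
  arcs \<open>(u, v)\<close> and \<open>(v, u)\<close>.
\<close>

text \<open>By symmetry the out-degree is the number of neighbours, i.e. the undirected degree.\<close>

definition deg :: "'a pair_pre_digraph \<Rightarrow> 'a \<Rightarrow> nat" where
  "deg G v = out_degree (with_proj G) v"

text \<open>
  The library's \<open>tree\<close> and \<open>forest\<close> are meant for digraphs without antiparallel arcs: there
  \<open>u, v, u\<close> already counts as a cycle, so that no symmetric graph with an edge would be a tree.
  The cycles of the undirected graph are the directed cycles of length at least three. Note that
  \<^const>\<open>connected\<close> includes non-emptiness.
\<close>

definition is_tree :: "'a pair_pre_digraph \<Rightarrow> bool" where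
  "is_tree G \<longleftrightarrow> pair_graph G \<and> connected (with_proj G) \<and>
     \<not> (\<exists>p. pre_digraph.cycle (with_proj G) p \<and> 3 \<le> length p)"

definition max_degree :: "'a pair_pre_digraph \<Rightarrow> nat" where
  "max_degree G = Max (deg G ` pverts G)"

definition trees :: "nat \<Rightarrow> nat \<Rightarrow> 'a pair_pre_digraph set" where
  "trees n \<Delta> = {T. is_tree T \<and> card (pverts T) = n \<and> max_degree T = \<Delta>}"

definition is_leaf :: "'a pair_pre_digraph \<Rightarrow> 'a \<Rightarrow> bool" where
  "is_leaf G v \<longleftrightarrow> v \<in> pverts G \<and> deg G v = 1"

definition is_support :: "'a pair_pre_digraph \<Rightarrow> 'a \<Rightarrow> bool" where
  "is_support G v \<longleftrightarrow> v \<in> pverts G \<and> (\<exists>u. is_leaf G u \<and> (v, u) \<in> parcs G)"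

definition uedges :: "'a pair_pre_digraph \<Rightarrow> 'a set set" where
  "uedges G = {{u, v} | u v. (u, v) \<in> parcs G}"

definition imbalance :: "'a pair_pre_digraph \<Rightarrow> 'a set \<Rightarrow> int" where
  "imbalance G e = (THE k. \<exists>u v. e = {u, v} \<and> k = \<bar>int (deg G u) - int (deg G v)\<bar>)"

lemma imbalance_doubleton [simp]:
  "imbalance G {u, v} = \<bar>int (deg G u) - int (deg G v)\<bar>"
  unfolding imbalance_def by (rule the_equality) (auto simp: doubleton_eq_iff)

definition irr :: "'a pair_pre_digraph \<Rightarrow> int" where
  "irr G = (\<Sum>e\<in>uedges G. imbalance G e)"

end

theory Submission
  imports Defs
begin

text \<open>
  Root the tree at \<open>v\<^sub>0\<close>. Among all vertices other than the root that have degree at least three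
  choose a deepest one, \<open>q\<close>; the vertex \<open>v\<^sub>l\<close> guarantees that there is one. By the choice of \<open>q\<close>
  the part of the tree below \<open>q\<close> consists of at least two pendant paths. Let \<open>y\<close> and \<open>z\<close> be two
  children of \<open>q\<close> and \<open>w\<close> the leaf at the end of the path through \<open>z\<close>. The new tree is obtained by
  cutting the path that starts at \<open>y\<close> off \<open>q\<close> and appending it to \<open>w\<close>.

  Only the degrees of \<open>q\<close> (one less) and of \<open>w\<close> (two instead of one) change. The edge from \<open>q\<close> to
  its parent gains at most one; the edges to the children of \<open>q\<close> do not gain, since these children
  have degree at most two; the edge above \<open>w\<close> loses at least one; and the edge above \<open>y\<close>, whose
  upper end now has degree two instead of at least three, loses at least one. So the
  irregularity drops (\<open>irr_regraft_less\<close>). The root keeps its degree, and the only vertex whose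
  degree grows ends up with degree two, so the maximum degree is unchanged (\<open>ex_regraft\<close>).

  The bookkeeping becomes easy when a tree is given by a parent function together with a level
  that decreases from each vertex to its parent: edges correspond to the vertices other than the
  root, the irregularity is a sum over these vertices, and moving a branch is a single function
  update. Every tree has this form (\<open>tree_imp_rooted_tree\<close>), and conversely every such
  structure is a tree (\<open>rooted_tree.is_tree_G\<close>), so acyclicity of the new graph
  amounts to exhibiting a new level function (\<open>rooted_tree.regraft\<close>).
\<close>

lemma ex_max_if_finite:
  fixes f :: "'a \<Rightarrow> 'b :: linorder"
  assumes "finite A" "A \<noteq> {}"
  shows "\<exists>a\<in>A. \<forall>b\<in>A. f b \<le> f a"
proof -
  obtain a where "a \<in> A" "Max (f ` A) = f a" using assms by (rule obtains_MAX)
  moreover have "f b \<le> Max (f ` A)" if "b \<in> A" for b using assms(1) that by simp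
  ultimately show ?thesis by auto
qed

section \<open>Degrees and cycles in graphs of pairs\<close>

lemma deg_conv_neighbours: "deg G v = card {u. (v, u) \<in> parcs G}"
proof -
  have "{e \<in> parcs G. fst e = v} = Pair v ` {u. (v, u) \<in> parcs G}" by force
  then show ?thesis
    by (simp add: deg_def out_degree_def out_arcs_def card_image inj_on_def)
qed

lemma pcas_nth:
  "pcas u es v \<Longrightarrow> i < length es \<Longrightarrow> fst (es ! i) = (if i = 0 then u else snd (es ! (i - 1)))"
proof (induction es arbitrary: u i)
  case (Cons e es)
  then show ?case by (cases i) (auto split: if_splits)
qed simp

lemma pcas_last: "pcas u es v \<Longrightarrow> es \<noteq> [] \<Longrightarrow> snd (last es) = v"
  by (induction es arbitrary: u) auto

text \<open>
  Reading a cycle as a sequence that is periodic on all of \<open>nat\<close> gives every vertex of the cycle a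
  predecessor and a successor, without a special case at the ends of the list of arcs.
\<close>

lemma cycle_vertex_sequence:
  assumes "pre_digraph.cycle (with_proj G) es" and "3 \<le> length es"
  shows "\<exists>x. (\<forall>j. (x j, x (Suc j)) \<in> parcs G) \<and> (\<forall>j. x (j mod length es) = x j)
    \<and> inj_on x {..<length es}"
proof -
  interpret pair_pre_digraph G .
  let ?n = "length es"
  obtain u where walk: "set es \<subseteq> parcs G" "pcas u es u"
      and "distinct (tl (pawalk_verts u es))"
    using assms(1) unfolding cycle_def awalk_def by auto
  moreover have "tl (pawalk_verts u es) = map snd es"
    using awalk_verts_conv'[of u es u] walk(2) assms(2) by auto
  ultimately have dist: "distinct (map snd es)" by simp
  have n: "?n > 0" "es \<noteq> []" using assms(2) by auto
  define x where "x j = snd (es ! (j mod ?n))" for j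
  have "(x j, x (Suc j)) \<in> parcs G" for j
  proof -
    have lt: "Suc j mod ?n < ?n" using n by simp
    have "fst (es ! (Suc j mod ?n)) = snd (es ! (j mod ?n))"
    proof (cases "Suc (j mod ?n) = ?n")
      case True
      then have "Suc j mod ?n = 0" "j mod ?n = ?n - 1" by (simp_all add: mod_Suc)
      then show ?thesis
        using pcas_nth[OF walk(2), of 0] pcas_last[OF walk(2)] n by (simp add: last_conv_nth)
    next
      case False
      then have "Suc j mod ?n = Suc (j mod ?n)" by (simp add: mod_Suc)
      then show ?thesis using pcas_nth[OF walk(2) lt] by simp
    qed
    moreover have "es ! (Suc j mod ?n) \<in> parcs G" using walk(1) lt nth_mem by blast
    ultimately show ?thesis unfolding x_def by (metis prod.collapse)
  qed
  moreover have "x (j mod ?n) = x j" for j by (simp add: x_def)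
  moreover have "inj_on x {..<?n}"
    using dist by (auto simp: x_def inj_on_def distinct_conv_nth)
  ultimately show ?thesis by blast
qed

section \<open>Trees given by a parent function\<close>

definition child_rel :: "'a set \<Rightarrow> 'a \<Rightarrow> ('a \<Rightarrow> 'a) \<Rightarrow> 'a rel" where
  "child_rel V r par = {(par v, v) | v. v \<in> V - {r}}"

definition parent_graph :: "'a set \<Rightarrow> 'a \<Rightarrow> ('a \<Rightarrow> 'a) \<Rightarrow> 'a pair_pre_digraph" where
  "parent_graph V r par = \<lparr> pverts = V, parcs = child_rel V r par \<union> (child_rel V r par)\<inverse> \<rparr>"

definition children :: "'a set \<Rightarrow> 'a \<Rightarrow> ('a \<Rightarrow> 'a) \<Rightarrow> 'a \<Rightarrow> 'a set" where
  "children V r par v = {c \<in> V - {r}. par c = v}"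

lemma mem_child_rel: "(u, v) \<in> child_rel V r par \<longleftrightarrow> v \<in> V - {r} \<and> u = par v"
  by (auto simp: child_rel_def)

lemma parent_graph_simps [simp]:
  "pverts (parent_graph V r par) = V"
  "parcs (parent_graph V r par) = child_rel V r par \<union> (child_rel V r par)\<inverse>"
  by (simp_all add: parent_graph_def)

text \<open>
  The level need not be the distance from the root; any function that decreases towards the root
  excludes cycles. This slack is what makes it simple to give a level after a branch was moved.
\<close>

locale rooted_tree =
  fixes V :: "'a set" and r :: 'a and par :: "'a \<Rightarrow> 'a" and level :: "'a \<Rightarrow> nat"
  assumes finite_V: "finite V"
    and root_in: "r \<in> V"
    and par_in: "v \<in> V \<Longrightarrow> v \<noteq> r \<Longrightarrow> par v \<in> V"
    and level_par: "v \<in> V \<Longrightarrow> v \<noteq> r \<Longrightarrow> level (par v) < level v"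
begin

abbreviation "R \<equiv> child_rel V r par"
abbreviation "G \<equiv> parent_graph V r par"
abbreviation "ch \<equiv> children V r par"

lemma pair_graph_G: "pair_graph G"
proof
  show "finite (parcs G)"
    by (rule finite_subset[of _ "V \<times> V"]) (auto simp: finite_V mem_child_rel par_in)
  show "symmetric G"
    by (auto simp: symmetric_def sym_def)
  show "fst e \<noteq> snd e" if "e \<in> parcs G" for e
    using that level_par by (cases e) (force simp: mem_child_rel)
qed (auto simp: finite_V mem_child_rel par_in)

lemma root_reaches: "v \<in> V \<Longrightarrow> (r, v) \<in> R\<^sup>*"
proof (induction "level v" arbitrary: v rule: less_induct)
  case less
  show ?case
  proof (cases "v = r")
    case False
    then have "(r, par v) \<in> R\<^sup>*" using less level_par par_in by blast
    moreover have "(par v, v) \<in> R" using False less.prems by (simp add: mem_child_rel)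
    ultimately show ?thesis by (rule rtrancl_into_rtrancl)
  qed simp
qed

lemma reachable_G:
  assumes "u \<in> V" "v \<in> V"
  shows "u \<rightarrow>\<^sup>*\<^bsub>with_proj G\<^esub> v"
proof -
  interpret pair_graph G by (rule pair_graph_G)
  have "(u, r) \<in> (R\<inverse>)\<^sup>*" "(r, v) \<in> R\<^sup>*"
    using root_reaches assms by (auto simp: rtrancl_converse)
  then have "(u, r) \<in> (R \<union> R\<inverse>)\<^sup>*" "(r, v) \<in> (R \<union> R\<inverse>)\<^sup>*"
    by (meson in_rtrancl_UnI)+
  then have "(u, v) \<in> (R \<union> R\<inverse>)\<^sup>*" by simp
  then show ?thesis using assms by (simp add: reachable_conv')
qed

lemma connected_G: "connected (with_proj G)"
proof -
  interpret pair_graph G by (rule pair_graph_G)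
  show ?thesis
    unfolding connected_def strongly_connected_def
    using reachable_G root_in by (auto intro!: reachable_mk_symmetricI)
qed

text \<open>
  At a vertex of maximal level on a cycle both neighbours on the cycle must be its parent. As
  vertices do not repeat, the cycle then has length at most two.
\<close>

lemma no_cycle_G: "\<not> (\<exists>es. pre_digraph.cycle (with_proj G) es \<and> 3 \<le> length es)"
proof
  assume "\<exists>es. pre_digraph.cycle (with_proj G) es \<and> 3 \<le> length es"
  then obtain es where es: "pre_digraph.cycle (with_proj G) es" "3 \<le> length es" by blast
  let ?n = "length es"
  obtain x where arc_G: "\<And>j. (x j, x (Suc j)) \<in> parcs G"
    and per: "\<And>j. x (j mod ?n) = x j" and inj: "inj_on x {..<?n}"
    using cycle_vertex_sequence[OF es] by blast
  have arc: "(x j, x (Suc j)) \<in> R \<union> R\<inverse>" for j using arc_G[of j] by simp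
  have "finite {..<?n}" "0 \<in> {..<?n}" using es(2) by auto
  then obtain i where top_n: "\<And>j. j \<in> {..<?n} \<Longrightarrow> level (x j) \<le> level (x i)"
    using ex_max_if_finite[of "{..<?n}" "\<lambda>j. level (x j)"] by blast
  have top: "level (x j) \<le> level (x i)" for j
  proof -
    have "j mod ?n < ?n" using es(2) by (intro mod_less_divisor) linarith
    then show ?thesis using top_n[of "j mod ?n"] by (simp add: per)
  qed
  \<comment> \<open>Shifting by a full period keeps the index of the predecessor of \<open>x i\<close> a natural number.\<close>
  define k where "k = i + ?n - 1"
  have k: "Suc k = i + ?n" using es(2) by (simp add: k_def)
  have xk: "x (Suc k) = x i" using per[of "Suc k"] per[of i] by (simp add: k)
  have nb: "b = par (x i)" if "(x i, b) \<in> R \<union> R\<inverse>" "level b \<le> level (x i)" for b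
    using that level_par[of b] by (auto simp: mem_child_rel)
  have "x k = par (x i)" using arc[of k] top[of k] by (intro nb) (auto simp: xk)
  moreover have "x (Suc (Suc k)) = par (x i)"
    using arc[of "Suc k"] top[of "Suc (Suc k)"] by (intro nb) (auto simp: xk)
  ultimately have "x (k mod ?n) = x ((k + 2) mod ?n)" using per[of k] per[of "k + 2"] by simp
  moreover have "k mod ?n < ?n" "(k + 2) mod ?n < ?n"
    using es(2) by (intro mod_less_divisor; linarith)+
  ultimately have "(k + 2) mod ?n = k mod ?n" using inj by (auto dest: inj_onD)
  then have "?n dvd (k + 2) - k" by (metis mod_eq_dvd_iff_nat le_add1)
  then show False using es(2) by (auto dest: dvd_imp_le)
qed

lemma is_tree_G: "is_tree G"
  unfolding is_tree_def using pair_graph_G connected_G no_cycle_G by blast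

lemma deg_G:
  assumes "v \<in> V"
  shows "deg G v = card (ch v) + (if v = r then 0 else 1)"
proof -
  have fin: "finite (ch v)" by (simp add: children_def finite_V)
  have eq: "{u. (v, u) \<in> parcs G} = ch v \<union> (if v = r then {} else {par v})"
    using assms by (auto simp: mem_child_rel children_def)
  have "par v \<notin> ch v" if "v \<noteq> r"
    using level_par[of "par v"] level_par[OF assms that] by (auto simp: children_def)
  then show ?thesis unfolding deg_conv_neighbours eq using fin by auto
qed

text \<open>
  Each edge has exactly one lower end, so edges may be replaced by vertices other than the root.
\<close>

lemma irr_G: "irr G = (\<Sum>v\<in>V - {r}. \<bar>int (deg G v) - int (deg G (par v))\<bar>)"
proof -
  let ?e = "\<lambda>v. {v, par v}"
  have "uedges G = ?e ` (V - {r})"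
    unfolding uedges_def by (auto simp: mem_child_rel insert_commute)
  moreover have "inj_on ?e (V - {r})"
  proof (rule inj_onI)
    fix u v assume uv: "u \<in> V - {r}" "v \<in> V - {r}" "?e u = ?e v"
    show "u = v"
    proof (rule ccontr)
      assume "u \<noteq> v"
      then have "u = par v" "v = par u" using uv(3) by (auto simp: doubleton_eq_iff)
      then show False using level_par[of u] level_par[of v] uv by force
    qed
  qed
  ultimately show ?thesis unfolding irr_def by (simp add: sum.reindex)
qed

lemma descendant_level: "(u, v) \<in> R\<^sup>* \<Longrightarrow> level u \<le> level v"
  by (induction rule: rtrancl_induct) (use level_par in \<open>force simp: mem_child_rel\<close>)+

text \<open>
  The ancestors of a vertex form a chain, so two siblings with a common descendant would be
  comparable. But a descent from one sibling to another would enter the latter from their common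
  parent, whose level is smaller than that of the former.
\<close>

lemma siblings_disjoint:
  assumes "y \<in> ch q" "z \<in> ch q" "y \<noteq> z" "(z, w) \<in> R\<^sup>*"
  shows "(y, w) \<notin> R\<^sup>*"
proof
  have not_below: "(a, b) \<notin> R\<^sup>*" if "a \<in> ch q" "b \<in> ch q" "a \<noteq> b" for a b
  proof
    assume "(a, b) \<in> R\<^sup>*"
    then obtain c where "(a, c) \<in> R\<^sup>*" "(c, b) \<in> R" using \<open>a \<noteq> b\<close> by (meson rtranclE)
    then have "(a, q) \<in> R\<^sup>*" using that by (auto simp: mem_child_rel children_def)
    then show False using descendant_level[of a q] level_par[of a] that by (auto simp: children_def)
  qed
  assume "(y, w) \<in> R\<^sup>*"
  moreover have "single_valued (R\<inverse>)" by (auto simp: single_valued_def mem_child_rel)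
  ultimately have "(y, z) \<in> R\<^sup>* \<or> (z, y) \<in> R\<^sup>*"
    using single_valued_confluent[of "R\<inverse>" w y z] assms(4) by (auto simp: rtrancl_converse)
  then show False using not_below assms by blast
qed

text \<open>A descendant of maximal level has no child.\<close>

lemma descendant_leaf:
  assumes "z \<in> V"
  obtains w where "w \<in> V" "(z, w) \<in> R\<^sup>*" "ch w = {}"
proof -
  let ?D = "{v \<in> V. (z, v) \<in> R\<^sup>*}"
  have "finite ?D" "z \<in> ?D" using finite_V assms by auto
  then obtain w where w: "w \<in> ?D" and top: "\<And>v. v \<in> ?D \<Longrightarrow> level v \<le> level w"
    using ex_max_if_finite[of ?D level] by blast
  have "c \<notin> ch w" for c
  proof
    assume c: "c \<in> ch w"
    then have "(z, c) \<in> R\<^sup>*"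
      using w by (auto simp: children_def mem_child_rel intro: rtrancl_into_rtrancl)
    then show False using c top[of c] level_par[of c] by (auto simp: children_def)
  qed
  then show ?thesis using that w by blast
qed

text \<open>
  The branch at \<open>y\<close> may be hung under any vertex \<open>w\<close> outside of it: lifting the whole branch by more
  than the level of \<open>w\<close> makes the level decrease along the new edge and keeps all differences
  inside and outside the branch.
\<close>

lemma regraft:
  assumes "w \<in> V" "(y, w) \<notin> R\<^sup>*"
  shows "rooted_tree V r (par(y := w)) (\<lambda>v. if (y, v) \<in> R\<^sup>* then level v + level w + 1 else level v)"
proof
  fix v assume v: "v \<in> V" "v \<noteq> r"
  then have R: "(par v, v) \<in> R" by (simp add: mem_child_rel)
  show "(par(y := w)) v \<in> V" using v par_in assms(1) by simp
  have "(y, par v) \<in> R\<^sup>* \<longleftrightarrow> (y, v) \<in> R\<^sup>*" if "v \<noteq> y"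
    using R that by (auto simp: mem_child_rel elim: rtranclE intro: rtrancl_into_rtrancl)
  then show "(if (y, (par(y := w)) v) \<in> R\<^sup>* then level ((par(y := w)) v) + level w + 1
                else level ((par(y := w)) v))
     < (if (y, v) \<in> R\<^sup>* then level v + level w + 1 else level v)"
    using assms(2) level_par[OF v] by auto
qed (simp_all add: finite_V root_in)

end

text \<open>
  Take the distance from \<open>r\<close> as level and as parent any neighbour closer to \<open>r\<close>. The parent arcs
  already connect all vertices. Hence any further edge would close a cycle with the path between
  its ends along parent arcs, and that path has at least two arcs because the edge is not one of
  them.
\<close>

lemma tree_imp_rooted_tree:
  assumes "is_tree T" and "r \<in> pverts T"
  obtains par level where "rooted_tree (pverts T) r par level" and "T = parent_graph (pverts T) r par"
proof -
  let ?V = "pverts T" and ?A = "parcs T"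
  interpret pair_graph T using assms(1) by (simp add: is_tree_def)
  have reach: "(r, v) \<in> ?A\<^sup>*" if "v \<in> ?V" for v
  proof -
    have "strongly_connected (with_proj T)"
      using assms(1) symmetric_connected_imp_strongly_connected[OF pair_sym_arcs] by (simp add: is_tree_def)
    then show ?thesis using that assms(2) by (auto simp: strongly_connected_def reachable_conv')
  qed
  define level where "level v = (LEAST n. (r, v) \<in> ?A ^^ n)" for v
  have "\<exists>u. (u, v) \<in> ?A \<and> level u < level v" if v: "v \<in> ?V" "v \<noteq> r" for v
  proof -
    have "\<exists>n. (r, v) \<in> ?A ^^ n" using reach[OF v(1)] by (simp add: rtrancl_power)
    then have "(r, v) \<in> ?A ^^ level v" unfolding level_def by (rule LeastI_ex)
    moreover from this obtain m where m: "level v = Suc m" using v(2) by (cases "level v") auto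
    ultimately obtain u where "(r, u) \<in> ?A ^^ m" "(u, v) \<in> ?A" by auto
    moreover from this have "level u \<le> m" unfolding level_def by (intro Least_le)
    ultimately show ?thesis using m by auto
  qed
  then obtain par where par: "\<And>v. v \<in> ?V \<Longrightarrow> v \<noteq> r \<Longrightarrow> (par v, v) \<in> ?A \<and> level (par v) < level v"
    by metis
  interpret P: rooted_tree ?V r par level
    using par assms(2) by unfold_locales (auto simp: pair_finite_verts dest: in_arcsD1)
  have sym: "(b, a) \<in> ?A" if "(a, b) \<in> ?A" for a b
    using pair_sym_arcs that by (auto simp: symmetric_def sym_def)
  have sub: "parcs P.G \<subseteq> ?A" using par sym by (auto simp: mem_child_rel)
  have "?A \<subseteq> parcs P.G"
  proof (rule subrelI, rule ccontr)
    fix u v assume uv: "(u, v) \<in> ?A" and no: "(u, v) \<notin> parcs P.G"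
    interpret H: pair_graph P.G by (rule P.pair_graph_G)
    have V: "u \<in> ?V" "v \<in> ?V" using uv by (auto dest: in_arcsD1 in_arcsD2)
    then obtain es where es: "pre_digraph.apath (with_proj P.G) u es v"
      using P.reachable_G H.reachable_apath by blast
    have "u \<noteq> v" using pair_no_loops[OF uv] by simp
    have walk: "set es \<subseteq> parcs P.G" "pcas u es v" "distinct (pawalk_verts u es)"
      using es unfolding H.apath_def H.awalk_def by auto
    have "2 \<le> length es"
    proof (rule ccontr)
      assume "\<not> 2 \<le> length es"
      then consider "es = []" | e where "es = [e]"
        by (cases es) (auto simp: Suc_le_eq numeral_2_eq_2)
      then show False
      proof cases
        case (2 e)
        then have "e = (u, v)" using walk by (cases e) auto
        then show False using walk 2 no by simp
      qed (use walk \<open>u \<noteq> v\<close> in auto)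
    qed
    moreover have "cycle ((v, u) # es)"
    proof -
      have "awalk v ((v, u) # es) v" using V walk sub sym[OF uv] by (auto simp: awalk_def)
      then show ?thesis unfolding cycle_def using walk by auto
    qed
    ultimately show False using assms(1) unfolding is_tree_def by fastforce
  qed
  with sub have "T = P.G" by (intro pair_pre_digraph.equality) auto
  then show ?thesis using that P.rooted_tree_axioms by blast
qed

section \<open>Moving a branch to a leaf\<close>

context rooted_tree
begin

lemma deg_regraft:
  assumes "y \<in> ch q" "q \<noteq> r" "w \<in> V" "w \<noteq> r" "w \<noteq> q" "(y, w) \<notin> R\<^sup>*" "ch w = {}"
    and "v \<in> V"
  shows "deg (parent_graph V r (par(y := w))) v =
    (if v = q then deg G q - 1 else if v = w then 2 else deg G v)"
proof -
  interpret N: rooted_tree V r "par(y := w)"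
    "\<lambda>v. if (y, v) \<in> R\<^sup>* then level v + level w + 1 else level v"
    using assms by (intro regraft)
  have "N.ch q = ch q - {y}" "N.ch w = {y}" "v \<noteq> q \<Longrightarrow> v \<noteq> w \<Longrightarrow> N.ch v = ch v"
    using assms by (auto simp: children_def)
  moreover have "finite (ch q)" "card (ch q) > 0"
    using assms(1) finite_V by (auto simp: children_def card_gt_0_iff)
  ultimately show ?thesis
    using assms by (auto simp: N.deg_G deg_G card_Diff_singleton)
qed

text \<open>
  The terms of the sum for \<open>q\<close>, \<open>y\<close> and \<open>w\<close> change by at most \<open>1\<close>, \<open>- 1\<close> and \<open>- 1\<close>, and no other term
  grows. The bound on the degree of the parent of \<open>w\<close> is what makes the term for \<open>w\<close> shrink when
  the degree of \<open>w\<close> rises to two.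
\<close>

lemma irr_regraft_less:
  assumes y: "y \<in> ch q" and q: "q \<in> V" "q \<noteq> r" and w: "w \<in> V" "w \<noteq> r" "w \<noteq> q"
    and wy: "(y, w) \<notin> R\<^sup>*" and leaf: "ch w = {}"
    and deg_q: "3 \<le> deg G q" and deg_ch: "\<And>c. c \<in> ch q \<Longrightarrow> deg G c \<le> 2"
    and deg_pw: "2 \<le> deg G (par w)"
  shows "irr (parent_graph V r (par(y := w))) < irr G"
proof -
  interpret N: rooted_tree V r "par(y := w)"
    "\<lambda>v. if (y, v) \<in> R\<^sup>* then level v + level w + 1 else level v"
    using w wy by (intro regraft)
  note deg' = deg_regraft[OF y q(2) w wy leaf]
  let ?f = "\<lambda>v. \<bar>int (deg G v) - int (deg G (par v))\<bar>"
  let ?f' = "\<lambda>v. \<bar>int (deg N.G v) - int (deg N.G ((par(y := w)) v))\<bar>"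
  let ?\<delta> = "\<lambda>a v. if v = a then 1 else 0 :: int"
  have yV: "y \<in> V - {r}" "par y = q" using y by (auto simp: children_def)
  have ne: "y \<noteq> w" "y \<noteq> q" "par q \<noteq> q"
    using wy level_par[of y] level_par[of q] yV q by auto
  have deg_w: "deg G w = 1" using w leaf by (simp add: deg_G)
  have pw: "par v \<noteq> w" if "v \<in> V - {r}" for v using leaf that by (auto simp: children_def)
  have "?f' v \<le> ?f v + ?\<delta> q v - ?\<delta> y v - ?\<delta> w v" if v: "v \<in> V - {r}" for v
  proof -
    have pv: "par v \<in> V" using v par_in by blast
    consider "v = y" | "v = w" | "v = q" | "v \<in> ch q" "v \<noteq> y" "v \<noteq> w" "v \<noteq> q"
      | "v \<notin> ch q" "v \<noteq> y" "v \<noteq> w" "v \<noteq> q" by blast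
    then show ?thesis
    proof cases
      case 1
      then show ?thesis using deg_q deg_ch[OF y] ne yV q w by (simp add: deg')
    next
      \<comment> \<open>If \<open>w\<close> is a child of \<open>q\<close>, both ends of its edge change and the term drops by two.\<close>
      case 2
      then show ?thesis using deg_q deg_pw deg_w ne q w pv pw[OF v] by (auto simp: deg')
    next
      case 3
      then show ?thesis using deg_q ne q w pv pw[OF v] by (auto simp: deg')
    next
      case 4
      then have "par v = q" "deg G v \<le> 2" using deg_ch by (auto simp: children_def)
      then show ?thesis using 4 deg_q v w pv by (auto simp: deg')
    next
      case 5
      then have "par v \<noteq> q" using v by (auto simp: children_def)
      then show ?thesis using 5 v pv pw[OF v] by (auto simp: deg')
    qed
  qed
  then have "irr N.G \<le> (\<Sum>v\<in>V - {r}. ?f v + ?\<delta> q v - ?\<delta> y v - ?\<delta> w v)"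
    unfolding N.irr_G by (intro sum_mono)
  also have "\<dots> = irr G + 1 - 1 - 1"
    using finite_V q w yV by (simp add: irr_G sum.distrib sum_subtractf)
  finally show ?thesis by simp
qed

text \<open>
  A deepest vertex \<open>q\<close> of degree at least three other than the root only has children of degree at
  most two, and at least two of them; a leaf below one child is a place for the branch at
  another one.
\<close>

lemma ex_regraft:
  assumes "v \<in> V" "v \<noteq> r" "3 \<le> deg G v" "\<And>u. u \<in> V \<Longrightarrow> deg G u \<le> deg G r"
  obtains par' level' where "rooted_tree V r par' level'"
    "irr (parent_graph V r par') < irr G"
    "max_degree (parent_graph V r par') = deg G r"
proof -
  let ?B = "{v \<in> V - {r}. 3 \<le> deg G v}"
  have "finite ?B" "?B \<noteq> {}" using finite_V assms by auto
  then obtain q where qB: "q \<in> ?B" and top: "\<And>v. v \<in> ?B \<Longrightarrow> level v \<le> level q"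
    using ex_max_if_finite[of ?B level] by blast
  then have q: "q \<in> V" "q \<noteq> r" "3 \<le> deg G q" by auto
  have deg_ch: "deg G c \<le> 2" if "c \<in> ch q" for c
    using that top[of c] level_par[of c] by (force simp: children_def)
  have "\<not> card (ch q) \<le> Suc 0" "finite (ch q)"
    using q deg_G[of q] finite_V by (auto simp: children_def)
  then obtain y z where yz: "y \<in> ch q" "z \<in> ch q" "y \<noteq> z"
    using card_le_Suc0_iff_eq by blast
  obtain w where w: "w \<in> V" "(z, w) \<in> R\<^sup>*" "ch w = {}"
    using descendant_leaf yz(2) by (auto simp: children_def)
  have "level q < level w"
    using descendant_level[OF w(2)] level_par[of z] yz(2) by (auto simp: children_def)
  then have "w \<noteq> q" by auto
  have "w \<noteq> r" using w(2) yz(2) by (auto simp: children_def mem_child_rel elim: rtranclE)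
  have wy: "(y, w) \<notin> R\<^sup>*" using siblings_disjoint yz w by blast
  have pw: "par w \<in> V" "w \<in> ch (par w)" "finite (ch (par w))"
    using w \<open>w \<noteq> r\<close> par_in finite_V by (auto simp: children_def)
  then have "card (ch (par w)) > 0" by (auto simp: card_gt_0_iff)
  then have "2 \<le> deg G (par w)"
    using deg_G[OF pw(1)] assms(3) assms(4)[OF assms(1)] by (cases "par w = r") auto
  then have less: "irr (parent_graph V r (par(y := w))) < irr G"
    using irr_regraft_less[OF yz(1) q(1,2) w(1) \<open>w \<noteq> r\<close> \<open>w \<noteq> q\<close> wy w(3) q(3)] deg_ch by blast
  note deg' = deg_regraft[OF yz(1) q(2) w(1) \<open>w \<noteq> r\<close> \<open>w \<noteq> q\<close> wy w(3)]
  have "max_degree (parent_graph V r (par(y := w))) = deg G r"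
    unfolding max_degree_def
  proof (rule Max_eqI)
    show "deg G r \<in> deg (parent_graph V r (par(y := w))) ` pverts (parent_graph V r (par(y := w)))"
      using root_in q \<open>w \<noteq> r\<close> by (auto simp: deg' intro!: rev_image_eqI[of r])
  next
    fix d assume "d \<in> deg (parent_graph V r (par(y := w))) ` pverts (parent_graph V r (par(y := w)))"
    then obtain u where "u \<in> V" "d = deg (parent_graph V r (par(y := w))) u" by auto
    then show "d \<le> deg G r"
      using assms(3) assms(4)[OF assms(1)] assms(4)[of u] by (auto simp: deg')
  qed (simp add: finite_V)
  then show ?thesis using that regraft[OF w(1) wy] less by blast
qed

end

theorem proposition3p2:
  fixes T :: "'a pair_pre_digraph" and n \<Delta> :: nat and v\<^sub>0 v\<^sub>l :: 'a
  assumes "T \<in> trees n \<Delta>"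
    and "v\<^sub>0 \<in> pverts T" and "deg T v\<^sub>0 = \<Delta>"
    and "is_support T v\<^sub>l" and "v\<^sub>l \<noteq> v\<^sub>0" and "deg T v\<^sub>l \<ge> 3"
  shows "\<exists>T' :: 'a pair_pre_digraph. T' \<in> trees n \<Delta> \<and> irr T' < irr T"
proof -
  let ?V = "pverts T"
  have T: "is_tree T" "card ?V = n" "max_degree T = \<Delta>" using assms(1) by (auto simp: trees_def)
  obtain par level where "rooted_tree ?V v\<^sub>0 par level" and G: "T = parent_graph ?V v\<^sub>0 par"
    using tree_imp_rooted_tree[OF T(1) assms(2)] .
  then interpret rooted_tree ?V v\<^sub>0 par level by simp
  have le: "deg T u \<le> deg T v\<^sub>0" if "u \<in> ?V" for u
    using T(3) assms(3) that finite_V by (auto simp: max_degree_def intro!: Max_ge)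
  have "v\<^sub>l \<in> ?V" using assms(4) by (simp add: is_support_def)
  then obtain par' level' where N: "rooted_tree ?V v\<^sub>0 par' level'"
      "irr (parent_graph ?V v\<^sub>0 par') < irr T" "max_degree (parent_graph ?V v\<^sub>0 par') = \<Delta>"
    using ex_regraft[of v\<^sub>l] assms(3,5,6) le unfolding G[symmetric] by auto
  then have "parent_graph ?V v\<^sub>0 par' \<in> trees n \<Delta>"
    using rooted_tree.is_tree_G T(2) by (auto simp: trees_def)
  then show ?thesis using N(2) by blast
qed

end
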